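(* Let $n,p$ be positive integers, let $m_1\ge1$ and $m_2,\ldots,m_p\ge0$ be integers, and let $x\in(0,1]$. Then $$\begin{aligned}\zeta_n^\star(\mathbf m_p^\vee;x)=&\frac{(-1)^p\,n}{m_1!\cdots m_p!}\int_{x<t_p<\cdots<t_1<1}\frac{\log^{m_p}\!\left(\frac{1-x}{1-t_p}\right)}{t_p}\prod_{l=1}^{p-1}\frac{\log^{m_l}\!\left(\frac{1-t_{l+1}}{1-t_l}\right)}{t_l}\;t_1^n\,dt_1\cdots dt_p\\ &+\sum_{j=1}^p(-1)^{p-j}\,\zeta_n^\star(\mathbf m_j^\vee)\,\mathrm{Li}_{m_p+1,\,m_{p-1}+1,\,\ldots,\,m_{j+1}+1}(1-x),\end{aligned}$$ where for $j=p$ the polylogarithm has empty index and equals $1$ (and for $x=1$ the integral, being over the empty set, is $0$).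
   Context: $\mathrm{Li}_{k_1,\ldots,k_r}(x)=\sum_{n_1>\cdots>n_r\ge1}x^{n_1}/(n_1^{k_1}\cdots n_r^{k_r})$, $\mathrm{Li}_\emptyset=1$. $\zeta_n^\star(k_1,\ldots,k_r)=\sum_{n\ge n_1\ge\cdots\ge n_r\ge1}\prod n_j^{-k_j}$, and the parametric multiple harmonic star sum is $\zeta_n^\star(k_1,\ldots,k_r;x)=\sum_{n\ge n_1\ge\cdots\ge n_r\ge1}x^{n_r}/(n_1^{k_1}\cdots n_r^{k_r})$. Zeroth powers of logarithms are $1$. Put $\mathbf m_j=(m_1,m_2+1,\ldots,m_j+1)$, $\mathbf m_1=(m_1)$. The Hoffman dual of an index (finite sequence of positive integers) $\mathbf a=(a_1,\ldots,a_q)$ is the index $\mathbf a^\vee=(a'_1,\ldots,a'_{q'})$ of the same weight $|\mathbf a|=a_1+\cdots+a_q$ such that $\{1,\ldots,|\mathbf a|-1\}$ is the disjoint union of $\{a_1,a_1+a_2,\ldots,a_1+\cdots+a_{q-1}\}$ and $\{a'_1,a'_1+a'_2,\ldots,a'_1+\cdots+a'_{q'-1}\}$. *)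

theory Defs
  imports "HOL-Analysis.Analysis"
begin

definition is_index :: "nat list \<Rightarrow> bool" where
  "is_index ks \<longleftrightarrow> (\<forall>k\<in>set ks. k \<ge> 1)"

text \<open>The series converges absolutely for \<open>\<bar>x\<bar> < 1\<close>, so there the unordered sum over the
  tuples \<open>n\<^sub>1 > \<dots> > n\<^sub>r \<ge> 1\<close> is the usual multiple polylogarithm.\<close>

definition multi_polylog :: "nat list \<Rightarrow> real \<Rightarrow> real" where
  "multi_polylog ks x =
     (if ks = [] then 1
      else (\<Sum>\<^sub>\<infinity> ns \<in> {ns. length ns = length ks \<and> sorted_wrt (>) ns \<and> (\<forall>n\<in>set ns. n \<ge> 1)}.
              x ^ hd ns / (\<Prod>j<length ks. real (ns ! j) ^ (ks ! j))))"

definition star_tuples :: "nat \<Rightarrow> nat \<Rightarrow> nat list set" where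
  "star_tuples n r = {ns. length ns = r \<and> sorted_wrt (\<ge>) ns \<and> set ns \<subseteq> {1..n}}"

definition zeta_star :: "nat \<Rightarrow> nat list \<Rightarrow> real" where
  "zeta_star n ks =
     (\<Sum>ns\<in>star_tuples n (length ks). 1 / (\<Prod>j<length ks. real (ns ! j) ^ (ks ! j)))"

text \<open>Only meaningful for a nonempty index, since the exponent of \<open>x\<close> is the
  smallest summation variable.\<close>

definition zeta_star_param :: "nat \<Rightarrow> nat list \<Rightarrow> real \<Rightarrow> real" where
  "zeta_star_param n ks x =
     (\<Sum>ns\<in>star_tuples n (length ks). x ^ last ns / (\<Prod>j<length ks. real (ns ! j) ^ (ks ! j)))"

definition proper_partial_sums :: "nat list \<Rightarrow> nat set" where
  "proper_partial_sums ks = {sum_list (take i ks) |i. 1 \<le> i \<and> i < length ks}"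

definition hoffman_dual :: "nat list \<Rightarrow> nat list" where
  "hoffman_dual a =
     (THE b. is_index b \<and> sum_list b = sum_list a
        \<and> proper_partial_sums a \<union> proper_partial_sums b = {1..<sum_list a}
        \<and> proper_partial_sums a \<inter> proper_partial_sums b = {})"

text \<open>The index \<open>(m\<^sub>1, m\<^sub>2 + 1, \<dots>, m\<^sub>j + 1)\<close>, for \<open>j \<ge> 1\<close>.\<close>

definition m_index :: "(nat \<Rightarrow> nat) \<Rightarrow> nat \<Rightarrow> nat list" where
  "m_index m j = m 1 # map (\<lambda>l. m l + 1) [2..<Suc j]"

text \<open>Points \<open>(t\<^sub>1, \<dots>, t\<^sub>p)\<close> are functions on the index set \<open>{1..p}\<close>, integrated
  against the product measure; this set is the region \<open>x < t\<^sub>p < \<dots> < t\<^sub>1 < 1\<close>.\<close>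

definition ordered_simplex :: "nat \<Rightarrow> real \<Rightarrow> (nat \<Rightarrow> real) set" where
  "ordered_simplex p x =
     {t \<in> {1..p} \<rightarrow>\<^sub>E UNIV. x < t p \<and> (\<forall>l\<in>{1..<p}. t (l + 1) < t l) \<and> t 1 < 1}"

end

theory Submission
  imports Defs "HOL-Real_Asymp.Real_Asymp"
begin

text \<open>
  Put \<open>S\<^sub>0(t) = n t\<^sup>n\<close> and let \<open>S\<^sub>p(t)\<close> be the parametric star sum of the dual of \<open>\<^bold>m\<^sub>p\<close>. Passing from
  \<open>\<^bold>m\<^sub>p\<close> to \<open>\<^bold>m\<^sub>p\<^sub>+\<^sub>1\<close> raises the last part of the dual by one and appends \<open>m\<^sub>p\<^sub>+\<^sub>1\<close> ones, and with
  \<open>(K\<^sub>m f)(x) = \<integral>\<^sub>x\<^sup>1 log((1 - x) / (1 - t))\<^sup>m / m! f(t) dt / t\<close> this reads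
  \<open>S\<^sub>p(x) + (K S\<^sub>p\<^sub>-\<^sub>1)(x) = S\<^sub>p(1)\<close>, where \<open>K\<close> has exponent \<open>m\<^sub>p\<close>; on monomials this is integration by
  parts. Iterating produces the alternating sum of the theorem: the iterated operators applied to the
  constant \<open>1\<close> are the polylogarithms at \<open>1 - x\<close> (expand \<open>1 / t\<close> in powers of \<open>1 - t\<close>), and applied to
  \<open>S\<^sub>0\<close> they give the integral over the simplex (Tonelli). All these integrals have nonnegative
  integrands, so they are handled in the extended nonnegative reals; only the final alternating
  summation takes place in the reals.
\<close>

subsection \<open>Integrals of logarithm powers against polynomials\<close>

text \<open>The substitution u = (1 - t)/c turns this into u ln(u)^m -> 0 as u -> 0+. It disposes of
  the boundary term at t = 1 in the integration by parts below.\<close>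

lemma tendsto_mult_ln_power:
  assumes "c > 0"
  shows "((\<lambda>t::real. (t - 1) * ln (c / (1 - t)) ^ m) \<longlongrightarrow> 0) (at_left 1)"
proof -
  have "((\<lambda>u::real. u * ln u ^ m) \<longlongrightarrow> 0) (at_right 0)"
    by real_asymp
  moreover have "filterlim (\<lambda>t. (1 - t) / c) (at_right 0) (at_left (1::real))"
    using assms by real_asymp
  ultimately have "((\<lambda>t. (1 - t) / c * ln ((1 - t) / c) ^ m) \<longlongrightarrow> 0) (at_left (1::real))"
    by (rule filterlim_compose)
  \<comment> \<open>The factor undoes the substitution: t - 1 = -c u and ln(c/(1 - t)) = -ln
    u.\<close>
  hence "((\<lambda>t. - c * (- 1) ^ m * ((1 - t) / c * ln ((1 - t) / c) ^ m)) \<longlongrightarrow> - c * (- 1) ^ m * 0) (at_left (1::real))"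
    by (rule tendsto_mult_left)
  moreover have "\<forall>\<^sub>F t in at_left (1::real).
      - c * (- 1) ^ m * ((1 - t) / c * ln ((1 - t) / c) ^ m) = (t - 1) * ln (c / (1 - t)) ^ m"
    using eventually_at_left_real[of 0 "1::real", OF zero_less_one]
  proof eventually_elim
    case (elim t)
    have "ln (c / (1 - t)) = - ln ((1 - t) / c)"
      using elim assms by (simp add: ln_div)
    thus ?case using assms by (simp add: field_simps flip: power_mult_distrib)
  qed
  ultimately have "((\<lambda>t::real. (t - 1) * ln (c / (1 - t)) ^ m) \<longlongrightarrow> - c * (- 1) ^ m * 0) (at_left 1)"
    by (rule Lim_transform_eventually)
  thus ?thesis by simp
qed

text \<open>The factor 1/m! makes the derivative in t of \<open>lpow (Suc m) x t\<close> equal to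
  \<open>lpow m x t / (1 - t)\<close>, free of constants.\<close>

definition lpow :: "nat \<Rightarrow> real \<Rightarrow> real \<Rightarrow> real" where
  "lpow m x t = ln ((1 - x) / (1 - t)) ^ m / fact m"

lemma lpow_0 [simp]: "lpow 0 x t = 1"
  by (simp add: lpow_def)

lemma lpow_nonneg: "x \<le> t \<Longrightarrow> t \<le> 1 \<Longrightarrow> 0 \<le> lpow m x t"
  by (cases "t = 1") (auto simp: lpow_def field_simps)

text \<open>The integrand is the derivative of (t - 1) f(t) times \<open>lpow (Suc m) x t\<close>:
  the factor t - 1 cancels the pole of the logarithm's derivative. This product vanishes at both
  ends, at x because ln 1 = 0 and at 1 because t - 1 beats the logarithm.\<close>

lemma lpow_by_parts:
  assumes x: "x < 1"
    and f: "continuous_on {x..1} f"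
    and q: "\<And>t. t \<in> {x<..<1} \<Longrightarrow> ((\<lambda>t. (t - 1) * f t) has_real_derivative g t) (at t)"
  shows "((\<lambda>t. lpow (Suc m) x t * g t - lpow m x t * f t) has_integral 0) {x..1}"
proof -
  define F where "F = (\<lambda>t. (t - 1) * f t * lpow (Suc m) x t)"
  have "((\<lambda>t. lpow (Suc m) x t * g t - lpow m x t * f t) has_integral F 1 - F x) {x..1}"
  proof (rule fundamental_theorem_of_calculus_interior)
    show "(F has_vector_derivative lpow (Suc m) x t * g t - lpow m x t * f t) (at t)"
      if t: "t \<in> {x<..<1}" for t
    proof -
      have "((\<lambda>t. ln ((1 - x) / (1 - t))) has_real_derivative 1 / (1 - t)) (at t)"
        using t x by (auto intro!: derivative_eq_intros simp: divide_simps)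
      from DERIV_cdivide[OF DERIV_power_Suc[OF this, of m], of "fact (Suc m)"]
      have "((\<lambda>t. lpow (Suc m) x t) has_real_derivative lpow m x t / (1 - t)) (at t)"
        unfolding lpow_def by (rule DERIV_cong) (simp add: divide_simps)
      from DERIV_mult[OF q[OF t] this]
      have "((\<lambda>t. (t - 1) * f t * lpow (Suc m) x t) has_real_derivative
          g t * lpow (Suc m) x t + lpow m x t / (1 - t) * ((t - 1) * f t)) (at t)" .
      moreover have "g t * lpow (Suc m) x t + lpow m x t / (1 - t) * ((t - 1) * f t)
          = lpow (Suc m) x t * g t - lpow m x t * f t"
        using t by (simp add: field_simps)
      ultimately show ?thesis
        by (simp add: F_def mult.commute[of "lpow (Suc m) x t"] flip: has_real_derivative_iff_has_vector_derivative)
    qed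
    show "continuous_on {x..1} F"
      unfolding continuous_on
    proof
      fix t assume t: "t \<in> {x..1}"
      have ft: "(f \<longlongrightarrow> f t) (at t within {x..1})"
        using f t by (simp add: continuous_on)
      have "((\<lambda>t. (t - 1) * lpow (Suc m) x t) \<longlongrightarrow> (t - 1) * lpow (Suc m) x t) (at t within {x..1})"
      proof (cases "t = 1")
        \<comment> \<open>\<open>lpow\<close> is unbounded near 1, so continuity of the product
          there rests on the limit proved above.\<close>
        case True
        have "((\<lambda>t::real. (t - 1) * ln ((1 - x) / (1 - t)) ^ Suc m / fact (Suc m)) \<longlongrightarrow> 0 / fact (Suc m)) (at_left 1)"
          using x by (intro tendsto_divide tendsto_mult_ln_power tendsto_const) auto
        moreover have "at 1 within {x..1} = at_left (1::real)"
          using x by (rule at_within_Icc_at_left)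
        ultimately show ?thesis using True by (simp add: lpow_def)
      next
        case False
        thus ?thesis using t x unfolding lpow_def
          by (intro tendsto_intros) auto
      qed
      from tendsto_mult[OF ft this] show "(F \<longlongrightarrow> F t) (at t within {x..1})"
        by (simp add: F_def mult_ac)
    qed
  qed (use x in auto)
  moreover have "F 1 = 0" "F x = 0"
    using x by (simp_all add: F_def lpow_def)
  ultimately show ?thesis by simp
qed

lemma lpow_by_parts_step:
  assumes "x < 1" "continuous_on {x..1} f"
    and "\<And>t. t \<in> {x<..<1} \<Longrightarrow> ((\<lambda>t. (t - 1) * f t) has_real_derivative g t) (at t)"
    and "((\<lambda>t. lpow m x t * f t) has_integral I) {x..1}"
  shows "((\<lambda>t. lpow (Suc m) x t * g t) has_integral I) {x..1}"
  using has_integral_add[OF lpow_by_parts[OF assms(1-3), of m] assms(4)] by simp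

lemma DERIV_one_minus_power:
  "((\<lambda>t. - ((1 - t) ^ Suc M) / real (Suc M)) has_real_derivative (1 - t) ^ M) (at t within S)"
proof -
  have "((\<lambda>t. (1 - t) ^ Suc M) has_real_derivative (1 + of_nat M) * (- 1 * (1 - t) ^ M)) (at t within S)"
    by (rule DERIV_power_Suc) (auto intro!: derivative_eq_intros)
  from DERIV_cdivide[OF DERIV_minus[OF this], of "real (Suc M)"] show ?thesis
    by (rule DERIV_cong) simp
qed

text \<open>The antiderivative of (1 - t)^M vanishing at 1 is (t - 1) (1 - t)^M / (M + 1), so every
  integration by parts contributes one more factor 1/(M + 1).\<close>

lemma lpow_moment:
  assumes "x < 1"
  shows "((\<lambda>t. lpow m x t * (1 - t) ^ M) has_integral (1 - x) ^ Suc M / real (Suc M) ^ Suc m) {x..1}"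
proof (induction m)
  case 0
  have "((\<lambda>t. (1 - t) ^ M) has_integral - ((1 - 1) ^ Suc M) / real (Suc M) - (- ((1 - x) ^ Suc M) / real (Suc M))) {x..1}"
    using assms by (intro fundamental_theorem_of_calculus)
      (use DERIV_one_minus_power in \<open>auto simp flip: has_real_derivative_iff_has_vector_derivative\<close>)
  thus ?case by simp
next
  case (Suc m)
  have "((\<lambda>t. lpow (Suc m) x t * (1 - t) ^ M) has_integral
      (1 - x) ^ Suc M / real (Suc M) ^ Suc m / real (Suc M)) {x..1}"
  proof (rule lpow_by_parts_step)
    show "((\<lambda>t. (t - 1) * ((1 - t) ^ M / real (Suc M))) has_real_derivative (1 - t) ^ M) (at t)" for t
    proof -
      note DERIV_one_minus_power[of M t UNIV]
      moreover have "(\<lambda>t. - ((1 - t) ^ Suc M) / real (Suc M)) = (\<lambda>t. (t - 1) * ((1 - t) ^ M / real (Suc M)))"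
        by (auto simp: field_simps)
      ultimately show ?thesis by simp
    qed
    show "((\<lambda>t. lpow m x t * ((1 - t) ^ M / real (Suc M))) has_integral
        (1 - x) ^ Suc M / real (Suc M) ^ Suc m / real (Suc M)) {x..1}"
      using has_integral_divide[OF Suc.IH, of "real (Suc M)"] by simp
  qed (use assms in \<open>auto intro!: continuous_intros\<close>)
  thus ?case by (simp add: mult_ac)
qed

text \<open>The effect on a function of the smallest summation variable of appending a part 1 to the
  index of a star sum.\<close>

definition star_unit :: "(nat \<Rightarrow> real) \<Rightarrow> nat \<Rightarrow> real" where
  "star_unit \<phi> N = (\<Sum>j=1..N. \<phi> j / real j)"

text \<open>The antiderivative of t^(N-1) vanishing at 1 is (t^N - 1)/N = (t - 1)(1 + t + ... +
  t^(N-1))/N. One integration by parts therefore replaces N by a sum over j \<le> N, which is one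
  application of \<open>star_unit\<close>.\<close>

lemma lpow_power:
  assumes "x < 1" "N \<ge> 1"
  shows "((\<lambda>t. lpow m x t * t ^ (N - 1)) has_integral
      (star_unit ^^ m) (\<lambda>N. 1 - x ^ N) N / real N) {x..1}"
  using assms(2)
proof (induction m arbitrary: N)
  case 0
  have "((\<lambda>t. t ^ (N - 1)) has_integral 1 ^ N / real N - x ^ N / real N) {x..1}"
    using assms(1) 0 by (intro fundamental_theorem_of_calculus)
      (auto intro!: derivative_eq_intros simp flip: has_real_derivative_iff_has_vector_derivative)
  thus ?case by (simp add: diff_divide_distrib)
next
  case (Suc m)
  have "((\<lambda>t. lpow m x t * ((\<Sum>j=1..N. t ^ (j - 1)) / real N)) has_integral
      (\<Sum>j=1..N. (star_unit ^^ m) (\<lambda>N. 1 - x ^ N) j / real j) / real N) {x..1}"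
    unfolding sum_divide_distrib sum_distrib_left times_divide_eq_right
    by (intro has_integral_sum has_integral_divide Suc.IH) auto
  hence "((\<lambda>t. lpow (Suc m) x t * t ^ (N - 1)) has_integral
      (\<Sum>j=1..N. (star_unit ^^ m) (\<lambda>N. 1 - x ^ N) j / real j) / real N) {x..1}"
  proof (rule lpow_by_parts_step[rotated 3])
    show "((\<lambda>t. (t - 1) * ((\<Sum>j=1..N. t ^ (j - 1)) / real N)) has_real_derivative t ^ (N - 1)) (at t)" for t
    proof -
      have "((\<lambda>t. (t ^ N - 1) / real N) has_real_derivative t ^ (N - 1)) (at t)"
        using Suc.prems by (auto intro!: derivative_eq_intros)
      moreover have "(\<Sum>j=1..N. t ^ (j - 1)) = (\<Sum>j<N. t ^ j)" for t :: real
        by (rule sum.reindex_bij_witness[of _ Suc "\<lambda>j. j - 1"]) auto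
      ultimately show ?thesis by (simp add: power_diff_1_eq)
    qed
  qed (use assms Suc.prems in \<open>auto intro!: continuous_intros\<close>)
  thus ?case by (simp add: star_unit_def[of "(star_unit ^^ m) _"])
qed

subsection \<open>Iterated logarithmic integral operators\<close>

lemma lpow_measurable [measurable]:
  assumes [measurable]: "f \<in> borel_measurable M" "g \<in> borel_measurable M"
  shows "(\<lambda>w. lpow m (f w) (g w)) \<in> borel_measurable M"
  unfolding lpow_def by measurable

text \<open>The limits of integration are part of the kernel, so every integral runs over the whole
  line and Tonelli applies directly.\<close>

definition log_kernel :: "nat \<Rightarrow> real \<Rightarrow> real \<Rightarrow> ennreal" where
  "log_kernel m x t = (if x < t \<and> t < 1 then ennreal (lpow m x t / t) else 0)"

definition log_op :: "nat \<Rightarrow> (real \<Rightarrow> ennreal) \<Rightarrow> real \<Rightarrow> ennreal" where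
  "log_op m f x = (\<integral>\<^sup>+ t. log_kernel m x t * f t \<partial>lborel)"

text \<open>The head of the list is the outermost operator, the one whose lower limit is the free
  variable x.\<close>

primrec log_ops :: "nat list \<Rightarrow> (real \<Rightarrow> ennreal) \<Rightarrow> real \<Rightarrow> ennreal" where
  "log_ops [] f = f"
| "log_ops (m # ms) f = log_op m (log_ops ms f)"

lemma log_kernel_measurable [measurable]:
  assumes [measurable]: "f \<in> borel_measurable M" "g \<in> borel_measurable M"
  shows "(\<lambda>w. log_kernel m (f w) (g w)) \<in> borel_measurable M"
  unfolding log_kernel_def by measurable

lemma log_op_measurable [measurable]:
  assumes [measurable]: "f \<in> borel_measurable borel"
  shows "log_op m f \<in> borel_measurable borel"
  unfolding log_op_def[abs_def] by measurable

lemma log_ops_measurable [measurable]: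
  "f \<in> borel_measurable borel \<Longrightarrow> log_ops ms f \<in> borel_measurable borel"
  by (induction ms) auto

lemma log_op_cong:
  assumes "\<And>t. x < t \<Longrightarrow> t < 1 \<Longrightarrow> f t = g t"
  shows "log_op m f x = log_op m g x"
  unfolding log_op_def by (rule nn_integral_cong) (auto simp: log_kernel_def assms)

lemma log_op_mono:
  assumes "\<And>t. x < t \<Longrightarrow> t < 1 \<Longrightarrow> f t \<le> g t"
  shows "log_op m f x \<le> log_op m g x"
  unfolding log_op_def by (rule nn_integral_mono) (auto simp: log_kernel_def assms mult_left_mono)

lemma log_op_add:
  assumes [measurable]: "f \<in> borel_measurable borel" "g \<in> borel_measurable borel"
  shows "log_op m (\<lambda>t. f t + g t) x = log_op m f x + log_op m g x"
  unfolding log_op_def by (simp add: distrib_left nn_integral_add)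

lemma log_op_cmult:
  assumes [measurable]: "f \<in> borel_measurable borel"
  shows "log_op m (\<lambda>t. c * f t) x = c * log_op m f x"
  unfolding log_op_def by (simp add: mult.left_commute[of _ c] nn_integral_cmult)

lemma log_op_sum:
  assumes [measurable]: "\<And>i. f i \<in> borel_measurable borel"
  shows "log_op m (\<lambda>t. \<Sum>i\<in>A. f i t) x = (\<Sum>i\<in>A. log_op m (f i) x)"
  unfolding log_op_def by (simp add: sum_distrib_left nn_integral_sum)

text \<open>Every kernel is supported to the right of its lower limit, so only values on [x, 1)
  enter; the point x itself is included for the empty list.\<close>

lemma log_ops_cong:
  assumes "\<And>t. x \<le> t \<Longrightarrow> t < 1 \<Longrightarrow> f t = g t" "x < 1"
  shows "log_ops ms f x = log_ops ms g x"
  using assms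
proof (induction ms arbitrary: x)
  case (Cons m ms)
  thus ?case by (auto intro!: log_op_cong)
qed auto

lemma log_ops_add:
  assumes [measurable]: "f \<in> borel_measurable borel" "g \<in> borel_measurable borel"
  shows "log_ops ms (\<lambda>t. f t + g t) x = log_ops ms f x + log_ops ms g x"
proof (induction ms arbitrary: x)
  case (Cons m ms)
  have "log_ops ms (\<lambda>t. f t + g t) = (\<lambda>t. log_ops ms f t + log_ops ms g t)"
    using Cons.IH by (simp add: fun_eq_iff)
  thus ?case by (simp add: log_op_add)
qed auto

lemma log_ops_cmult:
  assumes [measurable]: "f \<in> borel_measurable borel"
  shows "log_ops ms (\<lambda>t. c * f t) x = c * log_ops ms f x"
proof (induction ms arbitrary: x)
  case (Cons m ms)
  have "log_ops ms (\<lambda>t. c * f t) = (\<lambda>t. c * log_ops ms f t)"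
    using Cons.IH by (simp add: fun_eq_iff)
  thus ?case by (simp add: log_op_cmult)
qed auto

lemma log_ops_append: "log_ops (ms @ ms') f = log_ops ms (log_ops ms' f)"
  by (induction ms) auto

text \<open>Bridge from gauge integrals to nonnegative Lebesgue integrals: the integrand is
  nonnegative and the two endpoints form a null set.\<close>

lemma nn_integral_lpow:
  assumes I: "((\<lambda>t. lpow m x t * g t) has_integral I) {x..1}"
    and g: "g \<in> borel_measurable borel" "\<And>t. x < t \<Longrightarrow> t < 1 \<Longrightarrow> 0 \<le> g t"
  shows "(\<integral>\<^sup>+ t. (if x < t \<and> t < 1 then ennreal (lpow m x t * g t) else 0) \<partial>lborel) = ennreal I"
proof -
  note [measurable] = g(1)
  have "((\<lambda>t. if t \<in> {x<..<1} then lpow m x t * g t else 0) has_integral I) UNIV"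
    using I by (simp only: has_integral_restrict_UNIV has_integral_Icc_iff_Ioo)
  from nn_integral_has_integral_lborel[OF _ _ this]
  have "(\<integral>\<^sup>+ t. ennreal (if t \<in> {x<..<1} then lpow m x t * g t else 0) \<partial>lborel) = ennreal I"
    using g(2) by (fastforce intro!: mult_nonneg_nonneg lpow_nonneg)
  also have "(\<lambda>t. ennreal (if t \<in> {x<..<1} then lpow m x t * g t else 0)) =
      (\<lambda>t. if x < t \<and> t < 1 then ennreal (lpow m x t * g t) else 0)"
    by (auto simp: fun_eq_iff)
  finally show ?thesis .
qed

lemma log_op_power:
  assumes "0 < x" "x < 1" "N \<ge> 1"
  shows "log_op m (\<lambda>t. ennreal (t ^ N)) x = ennreal ((star_unit ^^ m) (\<lambda>N. 1 - x ^ N) N / real N)"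
proof -
  have "log_kernel m x t * ennreal (t ^ N)
      = (if x < t \<and> t < 1 then ennreal (lpow m x t * t ^ (N - 1)) else 0)" for t
    using assms by (cases N) (auto simp: log_kernel_def lpow_nonneg simp flip: ennreal_mult')
  thus ?thesis
    unfolding log_op_def using assms
    by (simp add: nn_integral_lpow[OF lpow_power])
qed

text \<open>Expand 1/t as the geometric series in 1 - t and integrate term by term. The term of
  exponent N + k has the moment with M = N + k + 1, and M > N is what produces the strict
  inequalities between the summation variables of the polylogarithm.\<close>

lemma log_op_one_minus_power:
  assumes "0 < x" "x < 1"
  shows "log_op m (\<lambda>t. ennreal ((1 - t) ^ N)) x
    = (\<integral>\<^sup>+ M. ennreal ((1 - x) ^ M / real M ^ Suc m) \<partial>count_space {N<..})"
proof -
  have "log_kernel m x t * ennreal ((1 - t) ^ N)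
      = (\<Sum>k. if x < t \<and> t < 1 then ennreal (lpow m x t * (1 - t) ^ (N + k)) else 0)" for t
  proof (cases "x < t \<and> t < 1")
    case True
    have "(\<lambda>k. (1 - t) ^ k) sums (1 / (1 - (1 - t)))"
      using True assms by (intro geometric_sums) auto
    from sums_mult[OF this, of "lpow m x t * (1 - t) ^ N"]
    have s: "(\<lambda>k. lpow m x t * (1 - t) ^ (N + k)) sums (lpow m x t / t * (1 - t) ^ N)"
      by (simp add: power_add mult_ac)
    have "0 \<le> lpow m x t" using True by (intro lpow_nonneg) auto
    have "(\<Sum>k. ennreal (lpow m x t * (1 - t) ^ (N + k))) = ennreal (lpow m x t / t * (1 - t) ^ N)"
      using \<open>0 \<le> lpow m x t\<close> True by (intro suminf_ennreal_eq[OF _ s]) simp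
    also have "\<dots> = log_kernel m x t * ennreal ((1 - t) ^ N)"
      unfolding log_kernel_def if_P[OF True]
      using True assms \<open>0 \<le> lpow m x t\<close> by (intro ennreal_mult') simp
    finally show ?thesis
      unfolding if_P[OF True] by (rule sym)
  next
    case False
    show ?thesis unfolding log_kernel_def if_not_P[OF False] by simp
  qed
  hence "log_op m (\<lambda>t. ennreal ((1 - t) ^ N)) x
      = (\<integral>\<^sup>+ t. (\<Sum>k. if x < t \<and> t < 1 then ennreal (lpow m x t * (1 - t) ^ (N + k)) else 0) \<partial>lborel)"
    by (simp add: log_op_def)
  also have "\<dots> = (\<Sum>k. \<integral>\<^sup>+ t. (if x < t \<and> t < 1 then ennreal (lpow m x t * (1 - t) ^ (N + k)) else 0) \<partial>lborel)"
    by (rule nn_integral_suminf) measurable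
  also have "\<dots> = (\<Sum>k. ennreal ((1 - x) ^ Suc (N + k) / real (Suc (N + k)) ^ Suc m))"
    using assms by (subst nn_integral_lpow[OF lpow_moment]) auto
  also have "\<dots> = (\<integral>\<^sup>+ k. ennreal ((1 - x) ^ Suc (N + k) / real (Suc (N + k)) ^ Suc m) \<partial>count_space UNIV)"
    by (rule nn_integral_count_space_nat[symmetric])
  also have "\<dots> = (\<integral>\<^sup>+ M. ennreal ((1 - x) ^ M / real M ^ Suc m) \<partial>count_space {N<..})"
    by (rule nn_integral_bij_count_space)
      (rule bij_betwI[of _ _ _ "\<lambda>M. M - Suc N"], auto)
  finally show ?thesis .
qed

subsection \<open>Multiple polylogarithms as iterated integrals\<close>

definition decreasing_tuples :: "nat \<Rightarrow> nat list set" where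
  "decreasing_tuples r = {ns. length ns = r \<and> sorted_wrt (>) ns \<and> (\<forall>n\<in>set ns. n \<ge> 1)}"

text \<open>The value 0 at the empty tuple makes the condition on a first entry read n > 0, and
  gives the constant function 1 as (1 - x)^0.\<close>

definition top_entry :: "nat list \<Rightarrow> nat" where
  "top_entry ns = (if ns = [] then 0 else hd ns)"

definition polylog_denom :: "nat list \<Rightarrow> nat list \<Rightarrow> real" where
  "polylog_denom ks ns = (\<Prod>j<length ks. real (ns ! j) ^ (ks ! j))"

lemma polylog_denom_Cons: "polylog_denom (k # ks) (n # ns) = real n ^ k * polylog_denom ks ns"
  by (simp add: polylog_denom_def prod.lessThan_Suc_shift del: prod.lessThan_Suc)

lemma polylog_denom_nonneg: "0 \<le> polylog_denom ks ns"
  by (simp add: polylog_denom_def prod_nonneg)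

lemma decreasing_tuples_0: "decreasing_tuples 0 = {[]}"
  by (auto simp: decreasing_tuples_def)

lemma Cons_in_decreasing_tuples_iff:
  "n # ns \<in> decreasing_tuples (Suc r) \<longleftrightarrow> ns \<in> decreasing_tuples r \<and> n > top_entry ns"
  by (cases ns) (auto simp: decreasing_tuples_def top_entry_def)

lemma bij_betw_decreasing_tuples:
  "bij_betw (\<lambda>(ns, n). n # ns) (SIGMA ns:decreasing_tuples r. {top_entry ns<..}) (decreasing_tuples (Suc r))"
proof (rule bij_betwI[where g = "\<lambda>ns. (tl ns, hd ns)"])
  show "(\<lambda>ns. (tl ns, hd ns)) \<in> decreasing_tuples (Suc r) \<rightarrow> (SIGMA ns:decreasing_tuples r. {top_entry ns<..})"
  proof
    fix ns assume "ns \<in> decreasing_tuples (Suc r)"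
    thus "(tl ns, hd ns) \<in> (SIGMA ns:decreasing_tuples r. {top_entry ns<..})"
      by (cases ns) (auto simp: Cons_in_decreasing_tuples_iff, auto simp: decreasing_tuples_def)
  qed
qed (auto simp: Cons_in_decreasing_tuples_iff, auto simp: decreasing_tuples_def length_Suc_conv)

text \<open>Tonelli for counting measures with dependent fibres, obtained by extending both sums by
  zero to the full types.\<close>

lemma nn_integral_count_space_Sigma:
  "(\<integral>\<^sup>+ x. \<integral>\<^sup>+ y. f (x, y) \<partial>count_space (B x) \<partial>count_space A) = (\<integral>\<^sup>+ z. f z \<partial>count_space (Sigma A B))"
proof -
  have "(\<integral>\<^sup>+ z. f z \<partial>count_space (Sigma A B)) = (\<integral>\<^sup>+ z. f z * indicator (Sigma A B) z \<partial>count_space UNIV)"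
    by (simp add: nn_integral_count_space_indicator)
  also have "\<dots> = (\<integral>\<^sup>+ x. \<integral>\<^sup>+ y. f (x, y) * indicator (Sigma A B) (x, y) \<partial>count_space UNIV \<partial>count_space UNIV)"
    by (rule nn_integral_fst_count_space[symmetric])
  also have "\<dots> = (\<integral>\<^sup>+ x. (\<integral>\<^sup>+ y. f (x, y) * indicator (B x) y \<partial>count_space UNIV) * indicator A x \<partial>count_space UNIV)"
    by (intro nn_integral_cong) (auto simp: indicator_def)
  finally show ?thesis
    by (simp add: nn_integral_count_space_indicator)
qed

text \<open>Each further operator turns (1 - t)^N, with N the largest entry so far, into a sum over
  M > N with weight 1/M^(m+1); this prepends the entry M to the tuple.\<close>

lemma log_ops_one_conv_count_space:
  assumes "0 < x" "x < 1"
  shows "log_ops ms (\<lambda>_. 1) x = (\<integral>\<^sup>+ ns. ennreal ((1 - x) ^ top_entry ns / polylog_denom (map Suc ms) ns)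
      \<partial>count_space (decreasing_tuples (length ms)))"
  using assms
proof (induction ms arbitrary: x)
  case Nil
  thus ?case
    by (simp add: decreasing_tuples_0 nn_integral_count_space_finite top_entry_def polylog_denom_def)
next
  case (Cons m ms)
  let ?D = "decreasing_tuples (length ms)"
  let ?c = "\<lambda>ns. ennreal (1 / polylog_denom (map Suc ms) ns)"
  have "log_ops (m # ms) (\<lambda>_. 1) x
      = log_op m (\<lambda>t. \<integral>\<^sup>+ ns. ?c ns * ennreal ((1 - t) ^ top_entry ns) \<partial>count_space ?D) x"
    using Cons.prems unfolding log_ops.simps
    by (intro log_op_cong)
      (simp add: Cons.IH polylog_denom_nonneg flip: ennreal_mult')
  \<comment> \<open>Sum and integral may be exchanged because the set of tuples is countable and all
    terms are nonnegative.\<close>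
  also have "\<dots> = (\<integral>\<^sup>+ ns. log_op m (\<lambda>t. ?c ns * ennreal ((1 - t) ^ top_entry ns)) x \<partial>count_space ?D)"
    unfolding log_op_def
    by (subst nn_integral_count_space_nn_integral[symmetric]) (auto simp: nn_integral_cmult)
  also have "\<dots> = (\<integral>\<^sup>+ ns. \<integral>\<^sup>+ M. ?c ns * ennreal ((1 - x) ^ M / real M ^ Suc m) \<partial>count_space {top_entry ns<..} \<partial>count_space ?D)"
    using Cons.prems by (simp add: log_op_cmult log_op_one_minus_power nn_integral_cmult)
  also have "\<dots> = (\<integral>\<^sup>+ ns. \<integral>\<^sup>+ M. (\<lambda>(ns, M). ennreal ((1 - x) ^ top_entry (M # ns) / polylog_denom (map Suc (m # ms)) (M # ns))) (ns, M)
      \<partial>count_space {top_entry ns<..} \<partial>count_space ?D)"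
    using Cons.prems
    by (intro nn_integral_cong) (simp add: polylog_denom_Cons polylog_denom_nonneg top_entry_def mult_ac flip: ennreal_mult')
  also have "\<dots> = (\<integral>\<^sup>+ z. (\<lambda>(ns, M). ennreal ((1 - x) ^ top_entry (M # ns) / polylog_denom (map Suc (m # ms)) (M # ns))) z
      \<partial>count_space (SIGMA ns:?D. {top_entry ns<..}))"
    by (rule nn_integral_count_space_Sigma)
  also have "\<dots> = (\<integral>\<^sup>+ z. ennreal ((1 - x) ^ top_entry ((\<lambda>(ns, n). n # ns) z) / polylog_denom (map Suc (m # ms)) ((\<lambda>(ns, n). n # ns) z))
      \<partial>count_space (SIGMA ns:?D. {top_entry ns<..}))"
    by (simp add: case_prod_beta)
  also have "\<dots> = (\<integral>\<^sup>+ ns. ennreal ((1 - x) ^ top_entry ns / polylog_denom (map Suc (m # ms)) ns)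
      \<partial>count_space (decreasing_tuples (Suc (length ms))))"
    by (rule nn_integral_bij_count_space[OF bij_betw_decreasing_tuples])
  finally show ?case by simp
qed

text \<open>On the range of integration 1/t \<le> 1/x, and \<open>lpow m y\<close> has total mass 1
  - y for every m. The crude bound serves only to show finiteness.\<close>

lemma log_op_one_le:
  assumes "0 < x" "x \<le> y" "y < 1"
  shows "log_op m (\<lambda>_. 1) y \<le> ennreal (1 / x)"
proof -
  have "log_op m (\<lambda>_. 1) y \<le> (\<integral>\<^sup>+ t. (if y < t \<and> t < 1 then ennreal (lpow m y t * (1 / x)) else 0) \<partial>lborel)"
    unfolding log_op_def log_kernel_def
  proof (intro nn_integral_mono)
    fix t
    have "lpow m y t * (1 / t) \<le> lpow m y t * (1 / x)" if "y < t" "t < 1"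
      using that assms by (intro mult_left_mono lpow_nonneg frac_le) auto
    thus "(if y < t \<and> t < 1 then ennreal (lpow m y t / t) else 0) * 1
        \<le> (if y < t \<and> t < 1 then ennreal (lpow m y t * (1 / x)) else 0)"
      by (simp add: ennreal_leI)
  qed
  also have "\<dots> = ennreal ((1 - y) * (1 / x))"
    using has_integral_mult_left[OF lpow_moment[of y m 0], of "1 / x"] assms
    by (intro nn_integral_lpow) auto
  also have "\<dots> \<le> ennreal (1 / x)"
    using assms by (intro ennreal_leI) (auto simp: divide_right_mono)
  finally show ?thesis .
qed

lemma log_ops_one_le:
  assumes "0 < x" "x \<le> y" "y < 1"
  shows "log_ops ms (\<lambda>_. 1) y \<le> ennreal ((1 / x) ^ length ms)"
  using assms(2,3)
proof (induction ms arbitrary: y)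
  case (Cons m ms)
  have "log_ops (m # ms) (\<lambda>_. 1) y \<le> log_op m (\<lambda>t. ennreal ((1 / x) ^ length ms) * 1) y"
    using Cons by (auto intro!: log_op_mono)
  also have "\<dots> = ennreal ((1 / x) ^ length ms) * log_op m (\<lambda>_. 1) y"
    by (rule log_op_cmult) simp
  also have "\<dots> \<le> ennreal ((1 / x) ^ length ms) * ennreal (1 / x)"
    using assms(1) Cons.prems by (intro mult_left_mono log_op_one_le) auto
  also have "\<dots> = ennreal ((1 / x) ^ length (m # ms))"
    using assms(1) by (simp flip: ennreal_mult')
  finally show ?case .
qed auto

text \<open>Finiteness of the iterated integral gives summability of the series, without which
  \<open>infsum\<close> would be its default value.\<close>

lemma log_ops_one_eq_multi_polylog:
  assumes "0 < x" "x < 1"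
  shows "log_ops ms (\<lambda>_. 1) x = ennreal (multi_polylog (map Suc ms) (1 - x))"
proof (cases "ms = []")
  case False
  let ?f = "\<lambda>ns. (1 - x) ^ top_entry ns / polylog_denom (map Suc ms) ns"
  let ?D = "decreasing_tuples (length ms)"
  have fin: "(\<integral>\<^sup>+ ns. ennreal (?f ns) \<partial>count_space ?D) < \<infinity>"
    using log_ops_one_le[of x x ms] assms
    by (simp add: log_ops_one_conv_count_space[symmetric] order.strict_trans1)
  have nonneg: "0 \<le> ?f ns" for ns
    using assms by (simp add: polylog_denom_nonneg)
  have s: "Infinite_Set_Sum.abs_summable_on ?f ?D"
    unfolding abs_summable_on_def using fin nonneg
    by (intro integrableI_nonneg) auto
  have "log_ops ms (\<lambda>_. 1) x = ennreal (infsum ?f ?D)"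
    using nn_integral_conv_infsetsum[OF s nonneg] infsetsum_infsum[OF s] assms
    by (simp add: log_ops_one_conv_count_space)
  also have "infsum ?f ?D = multi_polylog (map Suc ms) (1 - x)"
    using False unfolding multi_polylog_def decreasing_tuples_def
    by (auto intro!: infsum_cong simp: top_entry_def polylog_denom_def)
  finally show ?thesis .
qed (simp add: multi_polylog_def)

lemma multi_polylog_nonneg:
  assumes "0 \<le> x"
  shows "0 \<le> multi_polylog ks x"
  unfolding multi_polylog_def using assms
  by (auto intro!: infsum_nonneg divide_nonneg_nonneg prod_nonneg)

subsection \<open>Hoffman duals\<close>

text \<open>Including 0 and the total gives a clean recursion on the list and records the weight, so
  that the set determines the index.\<close>

definition partial_sums :: "nat list \<Rightarrow> nat set" where
  "partial_sums a = (\<lambda>i. sum_list (take i a)) ` {..length a}"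

lemma partial_sums_Nil: "partial_sums [] = {0}"
  by (auto simp: partial_sums_def)

lemma partial_sums_Cons: "partial_sums (k # a) = insert 0 ((+) k ` partial_sums a)"
  unfolding partial_sums_def by (simp add: atMost_Suc_eq_insert_0 image_image)

lemma zero_in_partial_sums: "0 \<in> partial_sums a"
  by (force simp: partial_sums_def)

lemma partial_sums_eq: "partial_sums a = proper_partial_sums a \<union> {0, sum_list a}"
proof -
  have "{..length a} = {i. 1 \<le> i \<and> i < length a} \<union> {0, length a}"
    by auto
  hence "partial_sums a = (\<lambda>i. sum_list (take i a)) ` {i. 1 \<le> i \<and> i < length a} \<union> {0, sum_list a}"
    by (simp add: partial_sums_def)
  thus ?thesis
    by (auto simp: proper_partial_sums_def)
qed

lemma is_index_Cons [simp]: "is_index (k # a) \<longleftrightarrow> k \<ge> 1 \<and> is_index a"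
  by (auto simp: is_index_def)

lemma is_index_append [simp]: "is_index (a @ b) \<longleftrightarrow> is_index a \<and> is_index b"
  by (auto simp: is_index_def)

lemma head_in_partial_sums: "k \<in> partial_sums (k # a)"
  using zero_in_partial_sums[of a] by (force simp: partial_sums_Cons)

lemma partial_sums_Cons_ge: "j \<in> partial_sums (k # a) \<Longrightarrow> j = 0 \<or> k \<le> j"
  by (auto simp: partial_sums_Cons)

text \<open>As parts are positive, the first part is the least nonzero partial sum; strip it, shift
  back and induct.\<close>

lemma partial_sums_inject:
  "is_index a \<Longrightarrow> is_index b \<Longrightarrow> partial_sums a = partial_sums b \<Longrightarrow> a = b"
proof (induction a arbitrary: b)
  case Nil
  show ?case
  proof (cases b)
    case (Cons l b')
    have "l \<in> {0}"
      using head_in_partial_sums[of l b'] Nil(3) unfolding Cons partial_sums_Nil by blast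
    thus ?thesis using Nil(2) Cons by simp
  qed simp
next
  case (Cons k a)
  show ?case
  proof (cases b)
    case Nil
    have "k \<in> {0}"
      using head_in_partial_sums[of k a] Cons.prems(3) unfolding Nil partial_sums_Nil by blast
    thus ?thesis using Cons.prems(1) by simp
  next
    case b: (Cons l b')
    have eq: "partial_sums (k # a) = partial_sums (l # b')"
      using Cons.prems(3) unfolding b .
    have pos: "k \<ge> 1" "l \<ge> 1" using Cons.prems(1,2) unfolding b by simp_all
    have "k \<in> partial_sums (l # b')" "l \<in> partial_sums (k # a)"
      using head_in_partial_sums[of k a] head_in_partial_sums[of l b'] unfolding eq by auto
    from this[THEN partial_sums_Cons_ge] have kl: "k = l" using pos by linarith
    have "0 \<notin> (+) k ` partial_sums a" "0 \<notin> (+) k ` partial_sums b'"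
      using pos by auto
    hence "(+) k ` partial_sums a = (+) k ` partial_sums b'"
      using eq unfolding kl partial_sums_Cons by (metis insert_ident)
    hence "partial_sums a = partial_sums b'"
      by (simp add: inj_image_eq_iff)
    hence "a = b'" using Cons.prems(1,2) unfolding b by (intro Cons.IH) simp_all
    thus ?thesis using kl b by simp
  qed
qed

text \<open>The complement in \<open>{1..<sum_list a}\<close> fixes the proper partial sums of a
  dual; together with the weight they fix all its partial sums, hence the dual itself.\<close>

lemma hoffman_dual_eqI:
  assumes "is_index b" "sum_list b = sum_list a"
    and "proper_partial_sums a \<union> proper_partial_sums b = {1..<sum_list a}"
    and "proper_partial_sums a \<inter> proper_partial_sums b = {}"
  shows "hoffman_dual a = b"
  unfolding hoffman_dual_def
proof (rule the_equality)
  fix c assume c: "is_index c \<and> sum_list c = sum_list a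
      \<and> proper_partial_sums a \<union> proper_partial_sums c = {1..<sum_list a}
      \<and> proper_partial_sums a \<inter> proper_partial_sums c = {}"
  have "proper_partial_sums c = proper_partial_sums b"
    using c assms(3,4) by blast
  thus "c = b"
    using c assms(1,2) by (intro partial_sums_inject) (auto simp: partial_sums_eq)
qed (use assms in auto)

section \<open>Explicit duals of the indices \<open>m_index m j\<close>\<close>

lemma proper_partial_sums_singleton: "proper_partial_sums [k] = {}"
  by (auto simp: proper_partial_sums_def)

lemma proper_partial_sums_snoc:
  assumes "a \<noteq> []"
  shows "proper_partial_sums (a @ [k]) = insert (sum_list a) (proper_partial_sums a)"
proof -
  have "{i. 1 \<le> i \<and> i < length (a @ [k])} = insert (length a) {i. 1 \<le> i \<and> i < length a}"
    using assms by (cases a) auto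
  hence "(\<lambda>i. sum_list (take i (a @ [k]))) ` {i. 1 \<le> i \<and> i < length (a @ [k])}
      = insert (sum_list a) ((\<lambda>i. sum_list (take i a)) ` {i. 1 \<le> i \<and> i < length a})"
    by simp
  thus ?thesis
    by (simp add: proper_partial_sums_def setcompr_eq_image)
qed

lemma proper_partial_sums_append_ones:
  assumes "a \<noteq> []"
  shows "proper_partial_sums (a @ replicate r 1) = proper_partial_sums a \<union> {sum_list a..<sum_list a + r}"
proof (induction r)
  case (Suc r)
  have "proper_partial_sums (a @ replicate (Suc r) 1)
      = proper_partial_sums ((a @ replicate r 1) @ [1])"
    by (simp add: replicate_append_same)
  also have "\<dots> = insert (sum_list a + r) (proper_partial_sums (a @ replicate r 1))"
    using assms by (subst proper_partial_sums_snoc) (auto simp: sum_list_replicate)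
  finally show ?case using Suc.IH by auto
qed simp

definition bump_last :: "nat list \<Rightarrow> nat list" where
  "bump_last a = butlast a @ [Suc (last a)]"

lemma proper_partial_sums_bump_last:
  "a \<noteq> [] \<Longrightarrow> proper_partial_sums (bump_last a) = proper_partial_sums a"
  by (cases a rule: rev_cases; cases "butlast a = []")
    (simp_all add: bump_last_def proper_partial_sums_snoc proper_partial_sums_singleton)

text \<open>Closed recursion for the dual, with the counter shifted by one:
  \<open>m_dual m q\<close> belongs to \<open>m_index m (Suc q)\<close>.\<close>

primrec m_dual :: "(nat \<Rightarrow> nat) \<Rightarrow> nat \<Rightarrow> nat list" where
  "m_dual m 0 = replicate (m 1) 1"
| "m_dual m (Suc q) = bump_last (m_dual m q) @ replicate (m (Suc (Suc q))) 1"

lemma m_index_Suc_Suc: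
  "m_index m (Suc (Suc q)) = m_index m (Suc q) @ [Suc (m (Suc (Suc q)))]"
  by (simp add: m_index_def)

lemma m_dual_not_Nil: "m 1 \<ge> 1 \<Longrightarrow> m_dual m q \<noteq> []"
  by (cases q) (auto simp: bump_last_def)

text \<open>Let w be the old weight and k + 1 the appended part. The index gains the partial sum w,
  which the dual must avoid, so its last part grows by one; the dual must gain w + 1, ..., w + k, so
  k ones follow.\<close>

lemma hoffman_dual_m_index:
  assumes "m 1 \<ge> 1"
  shows "hoffman_dual (m_index m (Suc q)) = m_dual m q"
proof -
  have "is_index (m_dual m q) \<and> sum_list (m_dual m q) = sum_list (m_index m (Suc q))
    \<and> proper_partial_sums (m_index m (Suc q)) \<union> proper_partial_sums (m_dual m q)
        = {1..<sum_list (m_index m (Suc q))}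
    \<and> proper_partial_sums (m_index m (Suc q)) \<inter> proper_partial_sums (m_dual m q) = {}"
  proof (induction q)
    case 0
    obtain k where k: "m 1 = Suc k" using assms by (cases "m 1") auto
    have "proper_partial_sums (replicate (m 1) 1) = {1..<m 1}"
      using proper_partial_sums_append_ones[of "[1]" k] unfolding k
      by (simp add: proper_partial_sums_singleton)
    thus ?case
      by (simp add: m_index_def proper_partial_sums_singleton sum_list_replicate) (simp add: is_index_def)
  next
    case (Suc q)
    let ?a = "m_index m (Suc q)" and ?d = "m_dual m q" and ?k = "m (Suc (Suc q))"
    have ne: "?a \<noteq> []" "?d \<noteq> []" "bump_last ?d \<noteq> []"
      using assms by (auto simp: m_index_def m_dual_not_Nil bump_last_def)
    have sb: "sum_list (bump_last ?d) = Suc (sum_list ?d)"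
      using ne(2) by (cases ?d rule: rev_cases) (auto simp: bump_last_def)
    have "is_index (bump_last ?d)"
      using Suc.IH ne(2) by (cases ?d rule: rev_cases) (auto simp: bump_last_def)
    hence ix: "is_index (m_dual m (Suc q))"
      by (auto simp: is_index_def)
    have w: "sum_list ?a \<ge> 1" "sum_list ?d = sum_list ?a"
      using assms by (simp add: m_index_def) (use Suc.IH in blast)
    have sum: "sum_list (m_dual m (Suc q)) = sum_list (m_index m (Suc (Suc q)))"
      by (simp add: m_index_Suc_Suc sum_list_replicate sb w(2))
    have d: "proper_partial_sums (m_dual m (Suc q))
        = proper_partial_sums ?d \<union> {Suc (sum_list ?a)..<Suc (sum_list ?a) + ?k}"
      unfolding m_dual.simps proper_partial_sums_append_ones[OF ne(3)] sb w(2)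
      using ne by (simp add: proper_partial_sums_bump_last)
    have a: "proper_partial_sums (m_index m (Suc (Suc q)))
        = insert (sum_list ?a) (proper_partial_sums ?a)"
      using ne by (simp add: m_index_Suc_Suc proper_partial_sums_snoc)
    have IH: "proper_partial_sums ?a \<union> proper_partial_sums ?d = {1..<sum_list ?a}"
      "proper_partial_sums ?a \<inter> proper_partial_sums ?d = {}"
      using Suc.IH by blast+
    have "proper_partial_sums (m_index m (Suc (Suc q))) \<union> proper_partial_sums (m_dual m (Suc q))
        = {1..<sum_list ?a} \<union> insert (sum_list ?a) {Suc (sum_list ?a)..<Suc (sum_list ?a) + ?k}"
      unfolding a d IH(1)[symmetric] by blast
    also have "\<dots> = {1..<sum_list (m_index m (Suc (Suc q)))}"
      using w(1) by (auto simp: m_index_Suc_Suc)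
    finally have un: "proper_partial_sums (m_index m (Suc (Suc q))) \<union> proper_partial_sums (m_dual m (Suc q))
        = {1..<sum_list (m_index m (Suc (Suc q)))}" .
    \<comment> \<open>All old partial sums lie strictly below the old weight, so the new ones, which
      start there, cannot meet them.\<close>
    have "j \<in> {1..<sum_list ?a}" if "j \<in> proper_partial_sums ?a \<or> j \<in> proper_partial_sums ?d" for j
      using that IH(1) by blast
    hence "proper_partial_sums (m_index m (Suc (Suc q))) \<inter> proper_partial_sums (m_dual m (Suc q)) = {}"
      unfolding a d using IH(2) by fastforce
    with ix sum un show ?case by blast
  qed
  thus ?thesis by (intro hoffman_dual_eqI) auto
qed

subsection \<open>Star sums\<close>

text \<open>At the empty tuple the value n is the upper bound for the first entry to be
  appended.\<close>

definition bottom_entry :: "nat \<Rightarrow> nat list \<Rightarrow> nat" where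
  "bottom_entry n ns = (if ns = [] then n else last ns)"

text \<open>A general function of the smallest variable covers both kinds of star sum and lets the
  last part of the index be absorbed into that function.\<close>

definition star_sum :: "nat \<Rightarrow> nat list \<Rightarrow> (nat \<Rightarrow> real) \<Rightarrow> real" where
  "star_sum n ks \<phi> = (\<Sum>ns\<in>star_tuples n (length ks).
     \<phi> (bottom_entry n ns) / (\<Prod>j<length ks. real (ns ! j) ^ (ks ! j)))"

lemma finite_star_tuples: "finite (star_tuples n r)"
  by (rule finite_subset[OF _ finite_lists_length_eq[of "{1..n}" r]]) (auto simp: star_tuples_def)

lemma star_tuples_0: "star_tuples n 0 = {[]}"
  by (auto simp: star_tuples_def)

lemma snoc_in_star_tuples_iff:
  "ns @ [j] \<in> star_tuples n (Suc r) \<longleftrightarrow> ns \<in> star_tuples n r \<and> j \<in> {1..bottom_entry n ns}"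
  by (cases ns rule: rev_cases)
    (fastforce simp: star_tuples_def bottom_entry_def sorted_wrt_append)+

lemma bij_betw_star_tuples:
  "bij_betw (\<lambda>(ns, j). ns @ [j]) (SIGMA ns:star_tuples n r. {1..bottom_entry n ns}) (star_tuples n (Suc r))"
proof (rule bij_betwI[where g = "\<lambda>ns. (butlast ns, last ns)"])
  show "(\<lambda>ns. (butlast ns, last ns)) \<in> star_tuples n (Suc r) \<rightarrow> (SIGMA ns:star_tuples n r. {1..bottom_entry n ns})"
  proof
    fix ns assume *: "ns \<in> star_tuples n (Suc r)"
    hence "ns = butlast ns @ [last ns]"
      by (cases ns rule: rev_cases) (auto simp: star_tuples_def)
    with * show "(butlast ns, last ns) \<in> (SIGMA ns:star_tuples n r. {1..bottom_entry n ns})"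
      using snoc_in_star_tuples_iff[of "butlast ns" "last ns" n r] by auto
  qed
  show "(\<lambda>(ns, j). ns @ [j]) \<in> (SIGMA ns:star_tuples n r. {1..bottom_entry n ns}) \<rightarrow> star_tuples n (Suc r)"
    using snoc_in_star_tuples_iff by auto
next
  fix ns assume "ns \<in> star_tuples n (Suc r)"
  thus "(\<lambda>(ns, j). ns @ [j]) (butlast ns, last ns) = ns"
    by (cases ns rule: rev_cases) (auto simp: star_tuples_def)
qed auto

text \<open>The innermost variable is summed first, its range being bounded by the last entry of the
  remaining tuple.\<close>

lemma star_sum_snoc:
  "star_sum n (ks @ [k]) \<phi> = star_sum n ks (\<lambda>N. \<Sum>j=1..N. \<phi> j / real j ^ k)"
proof -
  have "star_sum n (ks @ [k]) \<phi> = (\<Sum>(ns, j)\<in>(SIGMA ns:star_tuples n (length ks). {1..bottom_entry n ns}).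
      \<phi> (bottom_entry n (ns @ [j])) / (\<Prod>i<Suc (length ks). real ((ns @ [j]) ! i) ^ ((ks @ [k]) ! i)))"
    using sum.reindex_bij_betw[OF bij_betw_star_tuples,
      of "\<lambda>ns. \<phi> (bottom_entry n ns) / (\<Prod>i<Suc (length ks). real (ns ! i) ^ ((ks @ [k]) ! i))" n "length ks"]
    by (simp add: star_sum_def case_prod_beta)
  also have "\<dots> = (\<Sum>ns\<in>star_tuples n (length ks). \<Sum>j=1..bottom_entry n ns.
      \<phi> (bottom_entry n (ns @ [j])) / (\<Prod>i<Suc (length ks). real ((ns @ [j]) ! i) ^ ((ks @ [k]) ! i)))"
    by (rule sum.Sigma[symmetric]) (auto simp: finite_star_tuples)
  also have "\<dots> = star_sum n ks (\<lambda>N. \<Sum>j=1..N. \<phi> j / real j ^ k)"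
    unfolding star_sum_def sum_divide_distrib
  proof (intro sum.cong refl)
    fix ns j assume "ns \<in> star_tuples n (length ks)"
    hence "length ns = length ks" by (simp add: star_tuples_def)
    thus "\<phi> (bottom_entry n (ns @ [j])) / (\<Prod>i<Suc (length ks). real ((ns @ [j]) ! i) ^ ((ks @ [k]) ! i))
        = \<phi> j / real j ^ k / (\<Prod>j<length ks. real (ns ! j) ^ (ks ! j))"
      by (simp add: bottom_entry_def nth_append mult.commute)
  qed
  finally show ?thesis .
qed

lemma star_sum_append_ones:
  "star_sum n (ks @ replicate r 1) \<phi> = star_sum n ks ((star_unit ^^ r) \<phi>)"
proof (induction r arbitrary: \<phi>)
  case (Suc r)
  have "star_sum n (ks @ replicate (Suc r) 1) \<phi> = star_sum n ((ks @ replicate r 1) @ [1]) \<phi>"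
    by (simp add: replicate_append_same)
  also have "\<dots> = star_sum n (ks @ replicate r 1) (star_unit \<phi>)"
    by (subst star_sum_snoc) (simp add: star_unit_def[abs_def])
  finally show ?case unfolding Suc.IH by (simp add: funpow_swap1)
qed simp

lemma star_sum_bump_last:
  "ks \<noteq> [] \<Longrightarrow> star_sum n (bump_last ks) \<phi> = star_sum n ks (\<lambda>N. \<phi> N / real N)"
  by (cases ks rule: rev_cases) (simp_all add: bump_last_def star_sum_snoc)

lemma zeta_star_eq_star_sum: "zeta_star n ks = star_sum n ks (\<lambda>_. 1)"
  by (simp add: zeta_star_def star_sum_def)

lemma zeta_star_param_eq_star_sum:
  "ks \<noteq> [] \<Longrightarrow> zeta_star_param n ks x = star_sum n ks (\<lambda>N. x ^ N)"
  unfolding zeta_star_param_def star_sum_def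
  by (intro sum.cong refl) (auto simp: bottom_entry_def star_tuples_def)

text \<open>Normalised so that also the passage from \<open>p = 0\<close> to \<open>p = 1\<close> is an instance of the recursion.\<close>

primrec dual_sum :: "nat \<Rightarrow> (nat \<Rightarrow> nat) \<Rightarrow> nat \<Rightarrow> (nat \<Rightarrow> real) \<Rightarrow> real" where
  "dual_sum n m 0 \<phi> = real n * \<phi> n"
| "dual_sum n m (Suc p) \<phi> = dual_sum n m p (\<lambda>N. (star_unit ^^ m (Suc p)) \<phi> N / real N)"

text \<open>The recursion mirrors \<open>m_dual\<close>: appended ones apply
  \<open>star_unit\<close>, the raised last part divides by N. At the start the factor n in
  \<open>dual_sum n m 0\<close> cancels the division by n.\<close>

lemma dual_sum_Suc_eq_star_sum:
  assumes "n \<ge> 1" "m 1 \<ge> 1"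
  shows "dual_sum n m (Suc q) \<phi> = star_sum n (hoffman_dual (m_index m (Suc q))) \<phi>"
  unfolding hoffman_dual_m_index[of m, OF assms(2)]
proof (induction q arbitrary: \<phi>)
  case 0
  show ?case using assms star_sum_append_ones[of n "[]" "m 1" \<phi>]
    by (simp add: star_sum_def[of n "[]"] star_tuples_0 bottom_entry_def)
next
  case (Suc q)
  have "dual_sum n m (Suc (Suc q)) \<phi>
      = star_sum n (m_dual m q) (\<lambda>N. (star_unit ^^ m (Suc (Suc q))) \<phi> N / real N)"
    by (subst dual_sum.simps(2)) (rule Suc.IH)
  also have "\<dots> = star_sum n (bump_last (m_dual m q)) ((star_unit ^^ m (Suc (Suc q))) \<phi>)"
    using m_dual_not_Nil[of m q] assms by (simp add: star_sum_bump_last)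
  also have "\<dots> = star_sum n (m_dual m (Suc q)) \<phi>"
    unfolding m_dual.simps(2) by (rule star_sum_append_ones[symmetric])
  finally show ?case .
qed

text \<open>A star sum is already such a combination, indexed by its tuples. In this form
  positivity, measurability and the action of \<open>log_op\<close> need checking on single powers
  only, whose exponents must be positive to absorb the 1/t of the kernel.\<close>

lemma dual_sum_representation:
  assumes "n \<ge> 1" "m 1 \<ge> 1"
  obtains A :: "nat list set" and c :: "nat list \<Rightarrow> real" and e :: "nat list \<Rightarrow> nat"
  where "finite A" "\<And>i. c i \<ge> 0" "\<And>i. i \<in> A \<Longrightarrow> e i \<ge> 1"
    "\<And>\<phi>. dual_sum n m p \<phi> = (\<Sum>i\<in>A. c i * \<phi> (e i))"
proof (cases p)
  case 0
  show ?thesis by (rule that[of "{[]}" "\<lambda>_. real n" "\<lambda>_. n"]) (use assms 0 in auto)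
next
  case (Suc q)
  let ?d = "hoffman_dual (m_index m (Suc q))"
  show ?thesis
  proof (rule that[of "star_tuples n (length ?d)" "\<lambda>ns. 1 / (\<Prod>j<length ?d. real (ns ! j) ^ (?d ! j))" "bottom_entry n"])
    show "1 \<le> bottom_entry n ns" if "ns \<in> star_tuples n (length ?d)" for ns
      using that assms last_in_set[of ns] by (auto simp: star_tuples_def bottom_entry_def subset_eq)
    show "0 \<le> 1 / (\<Prod>j<length ?d. real (ns ! j) ^ (?d ! j))" for ns
      by (intro divide_nonneg_nonneg prod_nonneg) auto
    show "dual_sum n m p \<phi> = (\<Sum>ns\<in>star_tuples n (length ?d).
        1 / (\<Prod>j<length ?d. real (ns ! j) ^ (?d ! j)) * \<phi> (bottom_entry n ns))" for \<phi>
      unfolding Suc dual_sum_Suc_eq_star_sum[of n m, OF assms] star_sum_def by simp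
  qed (rule finite_star_tuples)
qed

section \<open>Linearity and positivity of the dual sums, and their recursion under
  \<open>log_op\<close>\<close>

lemma star_unit_funpow_diff:
  "(star_unit ^^ r) (\<lambda>N. \<phi> N - \<psi> N) N = (star_unit ^^ r) \<phi> N - (star_unit ^^ r) \<psi> N"
proof (induction r arbitrary: N)
  case (Suc r)
  have "(star_unit ^^ Suc r) (\<lambda>N. \<phi> N - \<psi> N) N
      = (\<Sum>j=1..N. ((star_unit ^^ r) \<phi> j - (star_unit ^^ r) \<psi> j) / real j)"
    using Suc.IH by (simp add: star_unit_def[of "(star_unit ^^ r) _"])
  thus ?case
    by (simp add: star_unit_def[of "(star_unit ^^ r) _"] diff_divide_distrib sum_subtractf)
qed simp

lemma star_unit_funpow_nonneg:
  "(\<And>N. 0 \<le> \<phi> N) \<Longrightarrow> 0 \<le> (star_unit ^^ r) \<phi> N"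
proof (induction r arbitrary: N)
  case (Suc r)
  thus ?case by (auto simp: star_unit_def[of "(star_unit ^^ r) _"] intro!: sum_nonneg)
qed simp

lemma dual_sum_diff:
  "dual_sum n m p (\<lambda>N. \<phi> N - \<psi> N) = dual_sum n m p \<phi> - dual_sum n m p \<psi>"
  by (induction p arbitrary: \<phi> \<psi>)
    (simp_all add: right_diff_distrib star_unit_funpow_diff diff_divide_distrib)

lemma dual_sum_nonneg:
  assumes "n \<ge> 1" "m 1 \<ge> 1" "\<And>N. 0 \<le> \<phi> N"
  shows "0 \<le> dual_sum n m p \<phi>"
proof -
  obtain A :: "nat list set" and c e where "finite A" "\<And>i. c i \<ge> 0" "\<And>i. i \<in> A \<Longrightarrow> e i \<ge> 1"
    "\<And>\<phi>. dual_sum n m p \<phi> = (\<Sum>i\<in>A. c i * \<phi> (e i))"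
    using dual_sum_representation[of n m p, OF assms(1,2)] by blast
  thus ?thesis using assms(3) by (simp add: sum_nonneg)
qed

lemma dual_sum_measurable [measurable]:
  assumes "n \<ge> 1" "m 1 \<ge> 1"
  shows "(\<lambda>t. dual_sum n m p (\<lambda>N. t ^ N)) \<in> borel_measurable borel"
proof -
  obtain A :: "nat list set" and c e where A: "finite A" "\<And>i. c i \<ge> 0" "\<And>i. i \<in> A \<Longrightarrow> e i \<ge> 1"
    "\<And>\<phi>. dual_sum n m p \<phi> = (\<Sum>i\<in>A. c i * \<phi> (e i))"
    using dual_sum_representation[of n m p, OF assms(1,2)] by blast
  show ?thesis unfolding A(4) by measurable
qed

text \<open>On t^N the operator yields \<open>star_unit\<close> iterated on 1 - x^N, divided by N,
  which is the very function that \<open>dual_sum\<close> feeds from level p + 1 to level p. The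
  identity is kept additive because subtraction of extended nonnegative reals truncates.\<close>

lemma log_op_dual_sum:
  assumes "n \<ge> 1" "m 1 \<ge> 1" "0 < x" "x < 1"
  shows "ennreal (dual_sum n m (Suc p) (\<lambda>N. x ^ N))
      + log_op (m (Suc p)) (\<lambda>t. ennreal (dual_sum n m p (\<lambda>N. t ^ N))) x
    = ennreal (dual_sum n m (Suc p) (\<lambda>_. 1))"
proof -
  obtain A :: "nat list set" and c e where A: "finite A" "\<And>i. c i \<ge> 0" "\<And>i. i \<in> A \<Longrightarrow> e i \<ge> 1"
    "\<And>\<phi>. dual_sum n m p \<phi> = (\<Sum>i\<in>A. c i * \<phi> (e i))"
    using dual_sum_representation[of n m p, OF assms(1,2)] by blast
  let ?I = "\<lambda>N. (star_unit ^^ m (Suc p)) (\<lambda>N. 1 - x ^ N) N / real N"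
  have I: "0 \<le> ?I N" for N
    using assms by (intro divide_nonneg_nonneg star_unit_funpow_nonneg) (auto simp: power_le_one)
  have "log_op (m (Suc p)) (\<lambda>t. ennreal (dual_sum n m p (\<lambda>N. t ^ N))) x
      = log_op (m (Suc p)) (\<lambda>t. \<Sum>i\<in>A. ennreal (c i) * ennreal (t ^ e i)) x"
    using A(2) assms by (intro log_op_cong) (simp add: A(4) sum_ennreal flip: ennreal_mult')
  also have "\<dots> = (\<Sum>i\<in>A. ennreal (c i) * log_op (m (Suc p)) (\<lambda>t. ennreal (t ^ e i)) x)"
    by (simp add: log_op_sum log_op_cmult)
  also have "\<dots> = (\<Sum>i\<in>A. ennreal (c i) * ennreal (?I (e i)))"
    using A(3) assms by (intro sum.cong refl) (simp add: log_op_power)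
  also have "\<dots> = (\<Sum>i\<in>A. ennreal (c i * ?I (e i)))"
    using A(2) by (intro sum.cong refl ennreal_mult'[symmetric])
  also have "\<dots> = ennreal (dual_sum n m p ?I)"
    unfolding A(4) using A(2) I by (intro sum_ennreal mult_nonneg_nonneg)
  also have "dual_sum n m p ?I = dual_sum n m (Suc p) (\<lambda>_. 1) - dual_sum n m (Suc p) (\<lambda>N. x ^ N)"
    by (subst dual_sum_diff[symmetric]) simp
  finally have *: "log_op (m (Suc p)) (\<lambda>t. ennreal (dual_sum n m p (\<lambda>N. t ^ N))) x
      = ennreal (dual_sum n m (Suc p) (\<lambda>_. 1) - dual_sum n m (Suc p) (\<lambda>N. x ^ N))" .
  have "0 \<le> dual_sum n m (Suc p) (\<lambda>_. 1) - dual_sum n m (Suc p) (\<lambda>N. x ^ N)"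
    unfolding dual_sum_diff[symmetric] using assms by (intro dual_sum_nonneg) (auto simp: power_le_one)
  moreover have "0 \<le> dual_sum n m (Suc p) (\<lambda>N. x ^ N)"
    using assms by (intro dual_sum_nonneg) auto
  ultimately show ?thesis
    unfolding * by (subst ennreal_plus[symmetric]) auto
qed

subsection \<open>The integral over the ordered simplex\<close>

text \<open>The smallest variable is peeled off first and becomes the lower limit for the others;
  the order constraints of the simplex are carried by the kernels.\<close>

primrec simplex_integrand ::
    "(nat \<Rightarrow> nat) \<Rightarrow> (real \<Rightarrow> ennreal) \<Rightarrow> nat \<Rightarrow> (nat \<Rightarrow> real) \<Rightarrow> real \<Rightarrow> ennreal" where
  "simplex_integrand m h 0 t x = h x"
| "simplex_integrand m h (Suc p) t x
     = log_kernel (m (Suc p)) x (t (Suc p)) * simplex_integrand m h p t (t (Suc p))"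

lemma simplex_integrand_measurable [measurable]:
  assumes [measurable]: "h \<in> borel_measurable borel" "g \<in> borel_measurable M"
    and T: "\<And>i. i \<in> {1..p} \<Longrightarrow> (\<lambda>w. T w i) \<in> borel_measurable M"
  shows "(\<lambda>w. simplex_integrand m h p (T w) (g w)) \<in> borel_measurable M"
  using assms(2) T
proof (induction p arbitrary: g)
  case (Suc p)
  have [measurable]: "(\<lambda>w. T w (Suc p)) \<in> borel_measurable M"
    using Suc.prems by auto
  have [measurable]: "(\<lambda>w. simplex_integrand m h p (T w) (T w (Suc p))) \<in> borel_measurable M"
    using Suc.prems by (intro Suc.IH) auto
  show ?case using Suc.prems(1) by simp
qed simp

lemma simplex_integrand_fun_upd:
  "i > p \<Longrightarrow> simplex_integrand m h p (t(i := y)) x = simplex_integrand m h p t x"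
  by (induction p arbitrary: x) auto

lemma component_borel_measurable:
  fixes I :: "nat set"
  assumes "i \<in> I"
  shows "(\<lambda>t. t i) \<in> borel_measurable (\<Pi>\<^sub>M l\<in>I. lborel :: real measure)"
  using measurable_component_singleton[OF assms, of "\<lambda>_. lborel :: real measure"] by simp

text \<open>Tonelli, splitting off the coordinate p + 1 as the outer variable; hence the exponents
  are listed from m_p down to m_1.\<close>

lemma log_ops_eq_nn_integral_PiM:
  assumes [measurable]: "h \<in> borel_measurable borel"
  shows "log_ops (map m (rev [1..<Suc p])) h x
    = (\<integral>\<^sup>+ t. simplex_integrand m h p t x \<partial>(\<Pi>\<^sub>M l\<in>{1..p}. lborel))"
proof (induction p arbitrary: x)
  case 0
  show ?case by (simp add: PiM_empty)
next
  case (Suc p)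
  interpret product_sigma_finite "\<lambda>_::nat. lborel :: real measure" ..
  have [measurable]: "(\<lambda>t. simplex_integrand m h p t y) \<in> borel_measurable (\<Pi>\<^sub>M l\<in>{1..p}. lborel)" for y
    by (intro simplex_integrand_measurable component_borel_measurable) auto
  have "(\<integral>\<^sup>+ t. simplex_integrand m h (Suc p) t x \<partial>(\<Pi>\<^sub>M l\<in>{1..Suc p}. lborel))
      = (\<integral>\<^sup>+ t. simplex_integrand m h (Suc p) t x \<partial>(\<Pi>\<^sub>M l\<in>insert (Suc p) {1..p}. lborel))"
    by (simp add: atLeastAtMostSuc_conv)
  also have "\<dots> = (\<integral>\<^sup>+ y. \<integral>\<^sup>+ t. simplex_integrand m h (Suc p) (t(Suc p := y)) x
      \<partial>(\<Pi>\<^sub>M l\<in>{1..p}. lborel) \<partial>lborel)"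
    by (intro product_nn_integral_insert_rev simplex_integrand_measurable component_borel_measurable) auto
  also have "\<dots> = (\<integral>\<^sup>+ y. log_kernel (m (Suc p)) x y * (\<integral>\<^sup>+ t. simplex_integrand m h p t y
      \<partial>(\<Pi>\<^sub>M l\<in>{1..p}. lborel)) \<partial>lborel)"
    by (intro nn_integral_cong) (simp add: simplex_integrand_fun_upd nn_integral_cmult)
  also have "\<dots> = log_op (m (Suc p)) (log_ops (map m (rev [1..<Suc p])) h) x"
    by (simp only: log_op_def Suc.IH)
  finally show ?case by simp
qed

text \<open>Membership in \<open>ordered_simplex\<close> without the extensionality condition, with
  the lower bound as an argument so that it can move during the recursion.\<close>

definition simplex_cond :: "nat \<Rightarrow> (nat \<Rightarrow> real) \<Rightarrow> real \<Rightarrow> bool" where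
  "simplex_cond p t x \<longleftrightarrow> x < t p \<and> (\<forall>l\<in>{1..<p}. t (l + 1) < t l) \<and> t 1 < 1"

definition simplex_density :: "(nat \<Rightarrow> nat) \<Rightarrow> nat \<Rightarrow> nat \<Rightarrow> (nat \<Rightarrow> real) \<Rightarrow> real \<Rightarrow> real" where
  "simplex_density m n p t x = lpow (m p) x (t p) / t p
     * (\<Prod>l\<in>{1..<p}. lpow (m l) (t (l + 1)) (t l) / t l) * t 1 ^ n"

lemma simplex_cond_Suc:
  "simplex_cond (Suc (Suc q)) t x \<longleftrightarrow> x < t (Suc (Suc q)) \<and> simplex_cond (Suc q) t (t (Suc (Suc q)))"
proof -
  have "{1..<Suc (Suc q)} = insert (Suc q) {1..<Suc q}" by auto
  thus ?thesis by (auto simp: simplex_cond_def)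
qed

lemma simplex_density_Suc:
  "simplex_density m n (Suc (Suc q)) t x = lpow (m (Suc (Suc q))) x (t (Suc (Suc q))) / t (Suc (Suc q))
     * simplex_density m n (Suc q) t (t (Suc (Suc q)))"
  by (simp add: simplex_density_def prod.atLeastLessThan_Suc)

lemma simplex_cond_less_one: "simplex_cond (Suc q) t x \<Longrightarrow> x < 1"
  by (induction q arbitrary: x) (auto simp: simplex_cond_Suc, auto simp: simplex_cond_def)

lemma simplex_density_nonneg:
  "0 < x \<Longrightarrow> simplex_cond (Suc q) t x \<Longrightarrow> 0 \<le> simplex_density m n (Suc q) t x"
proof (induction q arbitrary: x)
  case 0
  thus ?case by (auto simp: simplex_cond_def simplex_density_def intro!: mult_nonneg_nonneg divide_nonneg_nonneg lpow_nonneg)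
next
  case (Suc q)
  let ?y = "t (Suc (Suc q))"
  have y: "x < ?y" "simplex_cond (Suc q) t ?y"
    using Suc.prems by (auto simp: simplex_cond_Suc)
  hence "?y < 1" by (intro simplex_cond_less_one)
  thus ?case unfolding simplex_density_Suc using y Suc
    by (intro mult_nonneg_nonneg divide_nonneg_nonneg lpow_nonneg Suc.IH) auto
qed

lemma simplex_integrand_eq:
  assumes "0 < x"
  shows "simplex_integrand m (\<lambda>s. ennreal (s ^ n)) (Suc q) t x
    = ennreal (if simplex_cond (Suc q) t x then simplex_density m n (Suc q) t x else 0)"
  using assms
proof (induction q arbitrary: x)
  case 0
  have "ennreal (lpow (m 1) x (t 1) / t 1) * ennreal (t 1 ^ n) = ennreal (lpow (m 1) x (t 1) / t 1 * t 1 ^ n)"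
    if "x < t 1" "t 1 < 1"
    using that 0 by (intro ennreal_mult'[symmetric] divide_nonneg_nonneg lpow_nonneg) auto
  thus ?case by (simp add: simplex_cond_def simplex_density_def log_kernel_def)
next
  case (Suc q)
  let ?y = "t (Suc (Suc q))"
  show ?case
  proof (cases "simplex_cond (Suc (Suc q)) t x")
    case True
    hence y: "x < ?y" "simplex_cond (Suc q) t ?y"
      by (auto simp: simplex_cond_Suc)
    have y1: "?y < 1" using simplex_cond_less_one y(2) .
    have "simplex_integrand m (\<lambda>s. ennreal (s ^ n)) (Suc (Suc q)) t x
        = ennreal (lpow (m (Suc (Suc q))) x ?y / ?y) * ennreal (simplex_density m n (Suc q) t ?y)"
      using y y1 Suc.prems
      by (subst simplex_integrand.simps(2)) (simp add: Suc.IH log_kernel_def del: simplex_integrand.simps)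
    also have "\<dots> = ennreal (simplex_density m n (Suc (Suc q)) t x)"
      unfolding simplex_density_Suc using y y1 Suc.prems
      by (intro ennreal_mult'[symmetric] divide_nonneg_nonneg lpow_nonneg) auto
    finally show ?thesis using True by simp
  next
    case False
    \<comment> \<open>Either x < \<open>?y\<close> fails and the kernel vanishes, or
      \<open>?y\<close> is positive and the induction hypothesis makes the inner integrand
      vanish.\<close>
    hence "log_kernel (m (Suc (Suc q))) x ?y = 0 \<or> simplex_integrand m (\<lambda>s. ennreal (s ^ n)) (Suc q) t ?y = 0"
      using Suc.prems by (cases "x < ?y") (simp_all add: simplex_cond_Suc Suc.IH log_kernel_def del: simplex_integrand.simps)
    thus ?thesis using False by (subst simplex_integrand.simps(2)) (auto simp del: simplex_integrand.simps)
  qed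
qed

lemma simplex_integral_eq_log_ops:
  assumes "0 < x" "p \<ge> 1"
  shows "(LINT t : ordered_simplex p x | (\<Pi>\<^sub>M l\<in>{1..p}. lborel).
           ln ((1 - x) / (1 - t p)) ^ m p / t p
           * (\<Prod>l\<in>{1..<p}. ln ((1 - t (l + 1)) / (1 - t l)) ^ m l / t l)
           * t 1 ^ n)
    = (\<Prod>l=1..p. fact (m l)) * enn2real (log_ops (map m (rev [1..<Suc p])) (\<lambda>t. ennreal (t ^ n)) x)"
    (is "set_lebesgue_integral ?M _ ?f = ?F * _")
proof -
  let ?g = "\<lambda>t. simplex_integrand m (\<lambda>s. ennreal (s ^ n)) p t x"
  obtain q where p: "p = Suc q" using assms(2) by (cases p) auto
  have [measurable]: "?g \<in> borel_measurable ?M"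
    by (intro simplex_integrand_measurable component_borel_measurable) auto
  have f: "?f t = ?F * simplex_density m n p t x" for t
  proof -
    have "{1..p} = insert p {1..<p}" using assms(2) by auto
    hence "?F = fact (m p) * (\<Prod>l\<in>{1..<p}. fact (m l))" by simp
    moreover have "(\<Prod>l\<in>{1..<p}. lpow (m l) (t (l + 1)) (t l) / t l)
        = (\<Prod>l\<in>{1..<p}. ln ((1 - t (l + 1)) / (1 - t l)) ^ m l / t l) / (\<Prod>l\<in>{1..<p}. fact (m l))"
      unfolding prod_dividef[symmetric] by (intro prod.cong) (auto simp: lpow_def)
    moreover have "(\<Prod>l\<in>{1..<p}. fact (m l)) \<noteq> (0 :: real)" by simp
    ultimately show ?thesis
      by (simp add: simplex_density_def lpow_def)
  qed
  have "(LINT t : ordered_simplex p x | ?M. ?f t) = (\<integral>t. ?F * enn2real (?g t) \<partial>?M)"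
    unfolding set_lebesgue_integral_def
  proof (rule Bochner_Integration.integral_cong[OF refl])
    fix t assume "t \<in> space ?M"
    hence "t \<in> ordered_simplex p x \<longleftrightarrow> simplex_cond p t x"
      by (auto simp: ordered_simplex_def simplex_cond_def space_PiM)
    moreover have "?g t = ennreal (if simplex_cond p t x then simplex_density m n p t x else 0)"
      unfolding p by (rule simplex_integrand_eq[OF assms(1)])
    moreover have "simplex_cond p t x \<Longrightarrow> 0 \<le> simplex_density m n p t x"
      unfolding p by (rule simplex_density_nonneg[OF assms(1)])
    ultimately show "indicat_real (ordered_simplex p x) t *\<^sub>R ?f t = ?F * enn2real (?g t)"
      unfolding f by (simp add: indicator_def)
  qed
  also have "\<dots> = ?F * (\<integral>t. enn2real (?g t) \<partial>?M)"
    by simp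
  \<comment> \<open>No integrability is required: an infinite value is sent to 0 on both
    sides.\<close>
  also have "(\<integral>t. enn2real (?g t) \<partial>?M) = enn2real (\<integral>\<^sup>+ t. ennreal (enn2real (?g t)) \<partial>?M)"
    by (intro integral_eq_nn_integral) auto
  also have "(\<integral>\<^sup>+ t. ennreal (enn2real (?g t)) \<partial>?M) = (\<integral>\<^sup>+ t. ?g t \<partial>?M)"
    unfolding p simplex_integrand_eq[OF assms(1)] by (intro nn_integral_cong ennreal_enn2real) simp
  also have "\<dots> = log_ops (map m (rev [1..<Suc p])) (\<lambda>t. ennreal (t ^ n)) x"
    by (rule log_ops_eq_nn_integral_PiM[symmetric]) simp
  finally show ?thesis .
qed

subsection \<open>Iterating the recursion\<close>

text \<open>Repeated substitution in e(j+1) = c(j+1) - e(j); each step flips all earlier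
  signs.\<close>

lemma alternating_unfold:
  fixes e c :: "nat \<Rightarrow> real"
  assumes "\<And>j. j < p \<Longrightarrow> e (Suc j) + e j = c (Suc j)"
  shows "e p = (- 1) ^ p * e 0 + (\<Sum>j=1..p. (- 1) ^ (p - j) * c j)"
  using assms
proof (induction p)
  case (Suc p)
  have "(\<Sum>j=1..p. (- 1) ^ (Suc p - j) * c j) = - (\<Sum>j=1..p. (- 1) ^ (p - j) * c j)"
    unfolding sum_negf[symmetric] by (intro sum.cong) (auto simp: Suc_diff_le)
  moreover have "e (Suc p) + e p = c (Suc p)" using Suc.prems by simp
  moreover have "e p = (- 1) ^ p * e 0 + (\<Sum>j=1..p. (- 1) ^ (p - j) * c j)"
    using Suc.prems by (intro Suc.IH) simp
  ultimately show ?case by simp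
qed simp

text \<open>\<open>E j\<close> applies the operators with exponents m_p, ..., m_(j+1) to the dual
  sum of level j. It runs from the iterated integral at j = 0 to the dual sum at j = p, and
  neighbouring values add up to a constant times a polylogarithm.\<close>

lemma dual_sum_eq_log_ops:
  assumes "n \<ge> 1" "m 1 \<ge> 1" "0 < x" "x < 1"
  shows "dual_sum n m p (\<lambda>N. x ^ N)
    = (- 1) ^ p * (real n * enn2real (log_ops (map m (rev [1..<Suc p])) (\<lambda>t. ennreal (t ^ n)) x))
      + (\<Sum>j=1..p. (- 1) ^ (p - j) * (dual_sum n m j (\<lambda>_. 1)
          * multi_polylog (map (\<lambda>l. m l + 1) (rev [j+1..<Suc p])) (1 - x)))"
proof -
  define ms where "ms j = map m (rev [Suc j..<Suc p])" for j
  define f where "f = (\<lambda>j t. ennreal (dual_sum n m j (\<lambda>N. t ^ N)))"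
  define E where "E j = log_ops (ms j) (f j) x" for j
  define C where "C j = dual_sum n m j (\<lambda>_. 1)" for j
  define L where "L j = multi_polylog (map Suc (ms j)) (1 - x)" for j
  have [measurable]: "f j \<in> borel_measurable borel" for j
    unfolding f_def using dual_sum_measurable[of n m j, OF assms(1,2)] by measurable
  have C: "0 \<le> C j" for j
    unfolding C_def using assms by (intro dual_sum_nonneg) auto
  have L: "0 \<le> L j" for j
    unfolding L_def using assms by (intro multi_polylog_nonneg) auto
  have ms: "ms j = ms (Suc j) @ [m (Suc j)]" if "j < p" for j
    using that by (simp add: ms_def upt_conv_Cons del: upt_Suc)
  have step: "E (Suc j) + E j = ennreal (C (Suc j) * L (Suc j))" if "j < p" for j
  proof -
    have "E (Suc j) + E j
        = log_ops (ms (Suc j)) (f (Suc j)) x + log_ops (ms (Suc j)) (log_op (m (Suc j)) (f j)) x"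
      unfolding E_def ms[OF that] log_ops_append by simp
    also have "\<dots> = log_ops (ms (Suc j)) (\<lambda>t. f (Suc j) t + log_op (m (Suc j)) (f j) t) x"
      by (rule log_ops_add[symmetric]) measurable
    \<comment> \<open>The recursion holds at every t in [x, 1), so it may be applied under the outer
      operators; the result is constant in t.\<close>
    also have "\<dots> = log_ops (ms (Suc j)) (\<lambda>t. ennreal (C (Suc j)) * 1) x"
      using assms log_op_dual_sum[of n m _ j, OF assms(1,2)]
      by (intro log_ops_cong) (auto simp: f_def C_def simp del: dual_sum.simps)
    also have "\<dots> = ennreal (C (Suc j)) * log_ops (ms (Suc j)) (\<lambda>_. 1) x"
      by (rule log_ops_cmult) simp
    also have "\<dots> = ennreal (C (Suc j) * L (Suc j))"
      using assms C by (simp add: log_ops_one_eq_multi_polylog L_def ennreal_mult')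
    finally show ?thesis .
  qed
  have "enn2real (E (Suc j)) + enn2real (E j) = C (Suc j) * L (Suc j)" if "j < p" for j
  proof -
    \<comment> \<open>The sum is a real number, so both summands are finite, as additivity of
      \<open>enn2real\<close> requires.\<close>
    have "E (Suc j) + E j < top" using step[OF that] by simp
    hence "E (Suc j) < top" "E j < top" by (auto simp: less_top[symmetric])
    hence "enn2real (E (Suc j) + E j) = enn2real (E (Suc j)) + enn2real (E j)"
      by (rule enn2real_plus)
    thus ?thesis using step[OF that] C L by simp
  qed
  hence "enn2real (E p) = (- 1) ^ p * enn2real (E 0) + (\<Sum>j=1..p. (- 1) ^ (p - j) * (C j * L j))"
    by (rule alternating_unfold)
  moreover have "enn2real (E p) = dual_sum n m p (\<lambda>N. x ^ N)"
    using assms by (simp add: E_def ms_def f_def dual_sum_nonneg)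
  moreover have "E 0 = ennreal (real n) * log_ops (ms 0) (\<lambda>t. ennreal (t ^ n)) x"
  proof -
    have "E 0 = log_ops (ms 0) (\<lambda>t. ennreal (real n) * ennreal (t ^ n)) x"
      unfolding E_def using assms by (intro log_ops_cong) (simp_all add: f_def ennreal_mult')
    also have "\<dots> = ennreal (real n) * log_ops (ms 0) (\<lambda>t. ennreal (t ^ n)) x"
      by (rule log_ops_cmult) simp
    finally show ?thesis .
  qed
  ultimately show ?thesis
    by (simp add: enn2real_mult C_def L_def ms_def comp_def del: upt_Suc)
qed

text \<open>Leading exponents are positive, so every term is a positive power of 0. This settles the
  endpoint x = 1.\<close>

lemma multi_polylog_zero:
  assumes "ks \<noteq> []"
  shows "multi_polylog ks 0 = 0"
proof -
  have "0 ^ hd ns / (\<Prod>j<length ks. real (ns ! j) ^ (ks ! j)) = 0"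
    if "length ns = length ks" "\<forall>n\<in>set ns. n \<ge> 1" for ns
  proof -
    have "hd ns \<in> set ns" using that(1) assms by (intro hd_in_set) auto
    hence "hd ns \<noteq> 0" using that(2) by force
    thus ?thesis by (simp add: power_0_left)
  qed
  thus ?thesis using assms unfolding multi_polylog_def by (auto intro!: infsum_0)
qed

theorem theorem2p7:
  fixes n p :: nat and m :: "nat \<Rightarrow> nat" and x :: real
  assumes "n \<ge> 1" and "p \<ge> 1" and "m 1 \<ge> 1" and "0 < x" and "x \<le> 1"
  shows "zeta_star_param n (hoffman_dual (m_index m p)) x =
      (-1) ^ p * real n / (\<Prod>l=1..p. fact (m l)) *
        (LINT t : ordered_simplex p x | (\<Pi>\<^sub>M l\<in>{1..p}. lborel).
           ln ((1 - x) / (1 - t p)) ^ m p / t p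
           * (\<Prod>l\<in>{1..<p}. ln ((1 - t (l + 1)) / (1 - t l)) ^ m l / t l)
           * t 1 ^ n)
      + (\<Sum>j=1..p. (-1) ^ (p - j) * zeta_star n (hoffman_dual (m_index m j))
           * multi_polylog (map (\<lambda>l. m l + 1) (rev [j+1..<Suc p])) (1 - x))"
proof -
  have dual: "hoffman_dual (m_index m j) \<noteq> []"
    "star_sum n (hoffman_dual (m_index m j)) \<phi> = dual_sum n m j \<phi>" if j: "j \<ge> 1" for j \<phi>
  proof -
    obtain q where q: "j = Suc q" using j by (cases j) auto
    show "hoffman_dual (m_index m j) \<noteq> []"
      unfolding q hoffman_dual_m_index[of m, OF assms(3)] by (rule m_dual_not_Nil[of m, OF assms(3)])
    show "star_sum n (hoffman_dual (m_index m j)) \<phi> = dual_sum n m j \<phi>"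
      unfolding q by (rule dual_sum_Suc_eq_star_sum[of n m, OF assms(1,3), symmetric])
  qed
  have lhs: "zeta_star_param n (hoffman_dual (m_index m p)) x = dual_sum n m p (\<lambda>N. x ^ N)"
    using dual[OF assms(2)] by (simp add: zeta_star_param_eq_star_sum)
  have zeta: "zeta_star n (hoffman_dual (m_index m j)) = dual_sum n m j (\<lambda>_. 1)" if "j \<in> {1..p}" for j
    using that by (simp add: zeta_star_eq_star_sum dual(2))
  show ?thesis
  proof (cases "x = 1")
    case True
    obtain q where q: "p = Suc q" using assms(2) by (cases p) auto
    have "ordered_simplex p 1 = {}"
      using simplex_cond_less_one[of q _ 1] by (auto simp: ordered_simplex_def simplex_cond_def q)
    \<comment> \<open>Only j = p has an empty index; the other polylogarithms vanish at 0.\<close>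
    moreover have "(\<Sum>j=1..p. (-1) ^ (p - j) * zeta_star n (hoffman_dual (m_index m j))
           * multi_polylog (map (\<lambda>l. m l + 1) (rev [j+1..<Suc p])) 0)
        = (\<Sum>j\<in>{p}. (-1) ^ (p - j) * zeta_star n (hoffman_dual (m_index m j))
           * multi_polylog (map (\<lambda>l. m l + 1) (rev [j+1..<Suc p])) 0)"
      using assms(2) by (intro sum.mono_neutral_right) (auto simp: multi_polylog_zero)
    moreover have "\<dots> = dual_sum n m p (\<lambda>_. 1)"
      using assms(2) zeta[of p] by (simp add: multi_polylog_def)
    moreover have "(^) (1 :: real) = (\<lambda>_. 1)"
      by (simp add: fun_eq_iff)
    ultimately show ?thesis
      unfolding lhs unfolding True by (simp add: set_lebesgue_integral_def del: upt_Suc)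
  next
    case False
    hence "x < 1" using assms(5) by simp
    moreover have "(\<Prod>l=1..p. fact (m l)) \<noteq> (0 :: real)" by simp
    ultimately show ?thesis
      unfolding lhs simplex_integral_eq_log_ops[OF assms(4,2)]
        dual_sum_eq_log_ops[of n m x p, OF assms(1,3,4) \<open>x < 1\<close>]
      using zeta by (simp add: mult.assoc del: upt_Suc)
  qed
qed

end
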